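(* There is an absolute constant $k>0$ such that the following holds. Let $T:C[0,1]\to C[0,1]$ be a positive linear operator such that $T(e_0)=e_0$, $T(e_1;x)\le x$ for all $x\in[0,1]$, and such that there are functions $T^\infty(e_1),T^\infty(e_2)\in C[0,1]$ with $$\lim_{m\to\infty}\|T^m(e_1)-T^\infty(e_1)\|=\lim_{m\to\infty}\|T^m(e_2)-T^\infty(e_2)\|=0.$$ Then there exists a positive linear operator $T^\infty:C[0,1]\to C[0,1]$ (whose values at $e_1$ and $e_2$ are the uniform limits of $T^m(e_1)$ and $T^m(e_2)$ as $m\to\infty$, respectively) such that for all $m\in\mathbb{N}$, $x\in[0,1]$ and $f\in C[0,1]$, $$|(T^m-T^\infty)(f;x)|\le k\,\omega_2\bigl(f,\sqrt{\lambda_m(x)}\bigr)+k\,\|f\|\,\delta_m(x),$$ where $$\lambda_m(x)=\max\{|(T^m-T^\infty)(e_1;x)|,\ |(T^\infty-T^m)(e_2;x)|\},\qquad \delta_m(x)=|(T^m-T^\infty)(e_1;x)|.$$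
   Context: $C[0,1]$ is the space of real-valued continuous functions on $[0,1]$ with the supremum norm $\|\cdot\|$. A linear operator $T:C[0,1]\to C[0,1]$ is positive if $f\ge 0$ implies $T(f)\ge 0$. $T(f;x)$ denotes the value of $T(f)$ at $x$, and $T^m$ is the $m$-fold composition (iterate) of $T$. $e_i(x)=x^i$ for $i=0,1,2$. The second modulus of smoothness of $f\in C[0,1]$ is $\omega_2(f,t)=\sup_{0<h\le t}\ \sup_{0\le x\le 1-2h}|f(x+2h)-2f(x+h)+f(x)|$ for $t\ge 0$, with the convention that a supremum over an empty set is $0$ (so only $h\le 1/2$ contributes, and $\omega_2(f,0)=0$). "Absolute constant" means independent of $T$, $m$, $x$ and $f$. *)

theory Defs
  imports "HOL-Analysis.Analysis"
begin

text \<open>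
  An element of $C[0,1]$ is represented by any function on the reals that is continuous on
  $[0,1]$; two such functions represent the same element iff they agree on $[0,1]$.
  Accordingly, equations and inequalities in $C[0,1]$ are stated on $[0,1]$ only, and an
  operator on $C[0,1]$ must respect agreement on $[0,1]$.
\<close>

definition C01 :: "(real \<Rightarrow> real) set" where
  "C01 = {f. continuous_on {0..1} f}"

definition eq01 :: "(real \<Rightarrow> real) \<Rightarrow> (real \<Rightarrow> real) \<Rightarrow> bool" where
  "eq01 f g \<longleftrightarrow> (\<forall>x\<in>{0..1}. f x = g x)"

definition supnorm01 :: "(real \<Rightarrow> real) \<Rightarrow> real" where
  "supnorm01 f = (SUP x\<in>{0..1}. \<bar>f x\<bar>)"

definition operator01 :: "((real \<Rightarrow> real) \<Rightarrow> real \<Rightarrow> real) \<Rightarrow> bool" where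
  "operator01 T \<longleftrightarrow>
     (\<forall>f\<in>C01. T f \<in> C01) \<and>
     (\<forall>f\<in>C01. \<forall>g\<in>C01. eq01 f g \<longrightarrow> eq01 (T f) (T g))"

definition linear_operator01 :: "((real \<Rightarrow> real) \<Rightarrow> real \<Rightarrow> real) \<Rightarrow> bool" where
  "linear_operator01 T \<longleftrightarrow> operator01 T \<and>
     (\<forall>f\<in>C01. \<forall>g\<in>C01. eq01 (T (\<lambda>x. f x + g x)) (\<lambda>x. T f x + T g x)) \<and>
     (\<forall>c. \<forall>f\<in>C01. eq01 (T (\<lambda>x. c * f x)) (\<lambda>x. c * T f x))"

definition positive_linear_operator01 :: "((real \<Rightarrow> real) \<Rightarrow> real \<Rightarrow> real) \<Rightarrow> bool" where
  "positive_linear_operator01 T \<longleftrightarrow> linear_operator01 T \<and>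
     (\<forall>f\<in>C01. (\<forall>x\<in>{0..1}. 0 \<le> f x) \<longrightarrow> (\<forall>x\<in>{0..1}. 0 \<le> T f x))"

definition e_fun :: "nat \<Rightarrow> real \<Rightarrow> real" where
  "e_fun i = (\<lambda>x. x ^ i)"

text \<open>On the reals the value of \<^term>\<open>Sup {}\<close> is unspecified, so the convention
  that an empty supremum is $0$ is made explicit.\<close>

definition sup0 :: "real set \<Rightarrow> real" where
  "sup0 A = (if A = {} then 0 else Sup A)"

definition omega2 :: "(real \<Rightarrow> real) \<Rightarrow> real \<Rightarrow> real" where
  "omega2 f t =
     sup0 ((\<lambda>h. sup0 ((\<lambda>x. \<bar>f (x + 2 * h) - 2 * f (x + h) + f x\<bar>) ` {0..1 - 2 * h})) ` {0<..t})"

definition delta_iter ::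
  "((real \<Rightarrow> real) \<Rightarrow> real \<Rightarrow> real) \<Rightarrow> ((real \<Rightarrow> real) \<Rightarrow> real \<Rightarrow> real) \<Rightarrow> nat \<Rightarrow> real \<Rightarrow> real" where
  "delta_iter T Tinf m x = \<bar>(T ^^ m) (e_fun 1) x - Tinf (e_fun 1) x\<bar>"

definition lambda_iter ::
  "((real \<Rightarrow> real) \<Rightarrow> real \<Rightarrow> real) \<Rightarrow> ((real \<Rightarrow> real) \<Rightarrow> real \<Rightarrow> real) \<Rightarrow> nat \<Rightarrow> real \<Rightarrow> real" where
  "lambda_iter T Tinf m x =
     max \<bar>(T ^^ m) (e_fun 1) x - Tinf (e_fun 1) x\<bar>
         \<bar>Tinf (e_fun 2) x - (T ^^ m) (e_fun 2) x\<bar>"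

end

theory Submission
  imports Defs
begin

text \<open>
  The condition $T(e_1;x)\le x$ makes $T$ increase every $h\in C[0,1]$ whose graph has at each
  point a supporting line of slope at most $0$ (a decreasing convex function): applying $T$ to
  the supporting line $h(x)+s(y-x)$ at $x$ gives $Th(x)\ge h(x)+s(T(e_1;x)-x)\ge h(x)$. By
  positivity the sequence $T^mh$ is then increasing in $m$, although $T^me_2$ by itself need not
  be monotone.

  Let $g$ be smooth with $|g''|\le A$ and $|g'|\le B$. Both functions
  $\frac A2e_2\pm g-(A+B)e_1$ are convex and decreasing, so their images under $T^m$ increase
  with $m$. Comparing two iterates at a point and keeping $\pm g$ on one side gives
  \[|(T^m-T^n)g|\le\tfrac A2|(T^m-T^n)e_2|+(A+B)|(T^m-T^n)e_1|.\]
  This is the lemma \<open>tangent_bounds_iterates\<close>, which carries the whole proof. Such $g$ are dense and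
  all iterates are contractions, so the convergence at $e_1$ and $e_2$ forces uniform convergence
  at every $f\in C[0,1]$; the limit is the operator $T^\infty$, and the same inequality holds
  with $T^\infty$ in place of $T^n$.

  For a general $f$ one replaces $f$ by a smooth $g$. With $w=\omega_2(f,\sqrt\lambda)$ and
  $h=\frac12\sqrt\lambda$ there is a $g$ with $|f-g|\le2w$ and $|g''|\le4w/h^2=16w/\lambda$
  (\<open>smooth_approximation\<close>): a second-order Steklov mean of $f$, after $f$ has been extended beyond
  $[0,1]$ by the lines that interpolate it at $0,2h$ and at $1-2h,1$. Since $|g'|$ is controlled by
  $\|g\|$ and $|g''|$, the terms add up to $44w+4\|f\|\delta$. Where $\lambda=0$ the same
  inequality shows that $T^m$ and $T^\infty$ agree on the dense set of smooth functions, hence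
  on $f$.
\<close>

section \<open>The second modulus of smoothness\<close>

text \<open>Differences are centred, and the step $0$ is admitted, so that the bound passes to
  reflected arguments without case distinctions and is nonnegative of its own accord.\<close>

definition second_diff_le :: "(real \<Rightarrow> real) \<Rightarrow> real \<Rightarrow> real \<Rightarrow> bool" where
  "second_diff_le f h w \<longleftrightarrow>
     (\<forall>c u. 0 \<le> u \<longrightarrow> u \<le> h \<longrightarrow> 0 \<le> c - u \<longrightarrow> c + u \<le> 1 \<longrightarrow>
        \<bar>f (c + u) - 2 * f c + f (c - u)\<bar> \<le> w)"

lemma second_diff_leD:
  assumes "second_diff_le f h w" "0 \<le> u" "u \<le> h" "0 \<le> c - u" "c + u \<le> 1"
  shows "\<bar>f (c + u) - 2 * f c + f (c - u)\<bar> \<le> w"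
  using assms unfolding second_diff_le_def by blast

lemma second_diff_le_nonneg:
  assumes "second_diff_le f h w" "0 \<le> h"
  shows "0 \<le> w"
  using second_diff_leD[OF assms(1), of 0 "1/2"] assms(2) by simp

lemma C01_abs_le_supnorm01:
  assumes "f \<in> C01" "x \<in> {0..1}"
  shows "\<bar>f x\<bar> \<le> supnorm01 f"
proof -
  have "continuous_on {0..1} (\<lambda>x. \<bar>f x\<bar>)"
    using assms(1) by (auto simp: C01_def intro!: continuous_intros)
  then have "compact ((\<lambda>x. \<bar>f x\<bar>) ` {0..1})"
    by (intro compact_continuous_image) auto
  then have "bdd_above ((\<lambda>x. \<bar>f x\<bar>) ` {0..1})"
    by (intro bounded_imp_bdd_above compact_imp_bounded)
  then show ?thesis
    unfolding supnorm01_def using assms(2) by (intro cSUP_upper)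
qed

text \<open>The two suprema in \<^const>\<open>omega2\<close> are genuine only because continuous functions
  are bounded on $[0,1]$; steps larger than $1/2$ enter the outer supremum with value $0$.\<close>

lemma second_diff_le_omega2:
  assumes f: "f \<in> C01" and t: "0 < t"
  shows "second_diff_le f t (omega2 f t)"
proof -
  define N where "N = supnorm01 f"
  define D where "D h x = \<bar>f (x + 2 * h) - 2 * f (x + h) + f x\<bar>" for h x
  define S where "S h = sup0 (D h ` {0..1 - 2 * h})" for h
  have om: "omega2 f t = Sup (S ` {0<..t})"
  proof -
    have "omega2 f t = sup0 (S ` {0<..t})"
      unfolding omega2_def S_def[abs_def] D_def[abs_def] ..
    then show ?thesis using t by (simp add: sup0_def)
  qed
  have D: "D h x \<le> 4 * N" if "0 < h" "0 \<le> x" "x \<le> 1 - 2 * h" for h x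
    using C01_abs_le_supnorm01[OF f, of x] C01_abs_le_supnorm01[OF f, of "x + h"]
      C01_abs_le_supnorm01[OF f, of "x + 2 * h"] that
    unfolding N_def D_def by auto
  have bD: "bdd_above (D h ` {0..1 - 2 * h})" if "0 < h" for h
    using D[OF that] by (auto intro!: bdd_aboveI[of _ "4 * N"])
  have N: "0 \<le> N" using C01_abs_le_supnorm01[OF f, of 0] by (auto simp: N_def)
  have S: "S h \<le> 4 * N" if "0 < h" for h
    using D[OF that] N by (auto simp: S_def sup0_def intro!: cSUP_least)
  have bS: "bdd_above (S ` {0<..t})"
    using S by (auto intro!: bdd_aboveI[of _ "4 * N"])
  have main: "D h x \<le> omega2 f t" if "0 < h" "h \<le> t" "0 \<le> x" "x \<le> 1 - 2 * h" for h x
  proof -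
    have "D h x \<le> S h"
      using that bD[of h] by (auto simp: S_def sup0_def intro!: cSUP_upper)
    also have "S h \<le> omega2 f t"
      unfolding om using that bS by (intro cSUP_upper) auto
    finally show ?thesis .
  qed
  \<comment> \<open>Some admissible step is needed to see that the supremum is nonnegative.\<close>
  have "0 \<le> D (min t (1/2)) 0" by (simp add: D_def)
  also have "\<dots> \<le> omega2 f t" using t by (intro main) auto
  finally have nn: "0 \<le> omega2 f t" .
  show ?thesis
    unfolding second_diff_le_def
  proof (intro allI impI)
    fix c u :: real
    assume u: "0 \<le> u" "u \<le> t" "0 \<le> c - u" "c + u \<le> 1"
    show "\<bar>f (c + u) - 2 * f c + f (c - u)\<bar> \<le> omega2 f t"
    proof (cases "u = 0")
      case False
      then show ?thesis using main[of u "c - u"] u by (simp add: D_def add.commute)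
    qed (use nn in simp)
  qed
qed

section \<open>Smoothing on the scale of the second modulus\<close>

text \<open>Let the error $F$ attain its largest modulus at $p$. Reflecting the nearer endpoint in
  $p$ stays inside the interval, and $F$ vanishes at that endpoint, so the second difference of
  $F$ centred at $p$ is at least $2|F(p)|-|F(p)|$ in modulus. Subtracting a line does not change
  second differences.\<close>

lemma linear_interpolation_error:
  fixes f :: "real \<Rightarrow> real"
  assumes f: "continuous_on {a..b} f" and ab: "a < b" and x: "x \<in> {a..b}"
    and w: "\<And>c u. \<lbrakk>0 \<le> u; a \<le> c - u; c + u \<le> b\<rbrakk> \<Longrightarrow> \<bar>f (c + u) - 2 * f c + f (c - u)\<bar> \<le> w"
  shows "\<bar>f x - (f a + (x - a) * ((f b - f a) / (b - a)))\<bar> \<le> w"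
proof -
  define s where "s = (f b - f a) / (b - a)"
  define F where "F x = f x - (f a + (x - a) * s)" for x
  have "continuous_on {a..b} (\<lambda>x. \<bar>F x\<bar>)"
    unfolding F_def by (intro continuous_intros f)
  then obtain p where p: "p \<in> {a..b}" and max: "\<And>y. y \<in> {a..b} \<Longrightarrow> \<bar>F y\<bar> \<le> \<bar>F p\<bar>"
    using continuous_attains_sup[of "{a..b}" "\<lambda>x. \<bar>F x\<bar>"] ab by auto
  have Fa: "F a = 0" and Fb: "F b = 0" using ab by (auto simp: F_def s_def)
  have D: "\<bar>F (c + u) - 2 * F c + F (c - u)\<bar> \<le> w" if "0 \<le> u" "a \<le> c - u" "c + u \<le> b" for c u
  proof -
    have "F (c + u) - 2 * F c + F (c - u) = f (c + u) - 2 * f c + f (c - u)"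
      by (simp add: F_def algebra_simps)
    then show ?thesis using w[OF that] by simp
  qed
  have "\<bar>F p\<bar> \<le> w"
  proof (cases "p \<le> (a + b) / 2")
    case True
    have "\<bar>F (p + (p - a)) - 2 * F p + F (p - (p - a))\<bar> \<le> w"
      using True p by (intro D) (auto simp: field_simps)
    moreover have "\<bar>F (p + (p - a))\<bar> \<le> \<bar>F p\<bar>"
      using True p by (intro max) (auto simp: field_simps)
    ultimately show ?thesis using Fa by simp
  next
    case False
    have "\<bar>F (p + (b - p)) - 2 * F p + F (p - (b - p))\<bar> \<le> w"
      using False p by (intro D) (auto simp: field_simps)
    moreover have "\<bar>F (p - (b - p))\<bar> \<le> \<bar>F p\<bar>"
      using False p by (intro max) (auto simp: field_simps)
    ultimately show ?thesis using Fb by simp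
  qed
  with max[OF x] show ?thesis by (simp add: F_def s_def)
qed

text \<open>Near $0$ the extension is within $w$ of a single line on all of $(-\infty,2h]$, by the
  previous lemma on $[0,2h]$. If $x-u<0$ with $u\le h$, all three points of the second
  difference lie in that half-line, whence the factor $1+2+1=4$. The right end is symmetric, and
  $h\le 1/2$ prevents a difference from leaving $[0,1]$ on both sides.\<close>

lemma extension_second_diff:
  assumes f: "f \<in> C01" and h: "0 < h" "h \<le> 1/2" and w: "second_diff_le f h w"
  obtains F :: "real \<Rightarrow> real" where
    "continuous_on UNIV F" "\<And>x. x \<in> {0..1} \<Longrightarrow> F x = f x"
    "\<And>x u. \<lbrakk>x \<in> {0..1}; 0 \<le> u; u \<le> h\<rbrakk> \<Longrightarrow> \<bar>F (x + u) - 2 * F x + F (x - u)\<bar> \<le> 4 * w"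
proof -
  define s0 where "s0 = (f (2 * h) - f 0) / (2 * h)"
  define s1 where "s1 = (f 1 - f (1 - 2 * h)) / (2 * h)"
  \<comment> \<open>At most one of the three parts varies with x; writing them in one formula makes
    continuity immediate.\<close>
  define F where "F x = f (max 0 (min 1 x)) + min x 0 * s0 + max (x - 1) 0 * s1" for x
  have fc: "continuous_on {0..1} f" using f by (simp add: C01_def)
  have "continuous_on UNIV (\<lambda>x. f (max 0 (min 1 x)))"
    by (rule continuous_on_compose2[OF fc]) (auto intro!: continuous_intros)
  then have cont: "continuous_on UNIV F"
    unfolding F_def by (intro continuous_intros)
  have FI: "F x = f x" if "x \<in> {0..1}" for x
    using that by (auto simp: F_def max_def min_def)
  have w0: "0 \<le> w" using second_diff_le_nonneg[OF w] h by simp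
  have L: "\<bar>F x - (f 0 + x * s0)\<bar> \<le> w" if "x \<le> 2 * h" for x
  proof (cases "x \<le> 0")
    case True
    then show ?thesis using w0 by (simp add: F_def)
  next
    case False
    have "\<bar>f x - (f 0 + (x - 0) * ((f (2 * h) - f 0) / (2 * h - 0)))\<bar> \<le> w"
    proof (rule linear_interpolation_error)
      show "continuous_on {0..2 * h} f" using fc h by (auto intro: continuous_on_subset)
      show "\<bar>f (c + u) - 2 * f c + f (c - u)\<bar> \<le> w"
        if "0 \<le> u" "0 \<le> c - u" "c + u \<le> 2 * h" for c u
        using that h by (intro second_diff_leD[OF w]) auto
    qed (use False that h in auto)
    then show ?thesis using FI[of x] False that h by (simp add: s0_def)
  qed
  have R: "\<bar>F x - (f 1 + (x - 1) * s1)\<bar> \<le> w" if "1 - 2 * h \<le> x" for x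
  proof (cases "1 \<le> x")
    case True
    then show ?thesis using w0 by (simp add: F_def)
  next
    case False
    have "\<bar>f x - (f (1 - 2 * h) + (x - (1 - 2 * h)) * ((f 1 - f (1 - 2 * h)) / (1 - (1 - 2 * h))))\<bar> \<le> w"
    proof (rule linear_interpolation_error)
      show "continuous_on {1 - 2 * h..1} f" using fc h by (auto intro: continuous_on_subset)
      show "\<bar>f (c + u) - 2 * f c + f (c - u)\<bar> \<le> w"
        if "0 \<le> u" "1 - 2 * h \<le> c - u" "c + u \<le> 1" for c u
        using that h by (intro second_diff_leD[OF w]) auto
    qed (use False that h in auto)
    moreover have "f (1 - 2 * h) + (x - (1 - 2 * h)) * s1 = f 1 + (x - 1) * s1"
      using h by (simp add: s1_def field_simps)
    ultimately show ?thesis using FI[of x] False that h by (simp add: s1_def)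
  qed
  have "\<bar>F (x + u) - 2 * F x + F (x - u)\<bar> \<le> 4 * w"
    if x: "x \<in> {0..1}" and u: "0 \<le> u" "u \<le> h" for x u
  proof -
    consider "x < u" | "1 - x < u" | "u \<le> x" "u \<le> 1 - x" by linarith
    then show ?thesis
    proof cases
      case 1
      have "F (x + u) - 2 * F x + F (x - u) =
        (F (x + u) - (f 0 + (x + u) * s0)) - 2 * (F x - (f 0 + x * s0))
          + (F (x - u) - (f 0 + (x - u) * s0))"
        by (simp add: algebra_simps)
      moreover note L[of "x + u"] L[of x] L[of "x - u"]
      ultimately show ?thesis using 1 u h by argo
    next
      case 2
      have "F (x + u) - 2 * F x + F (x - u) =
        (F (x + u) - (f 1 + (x + u - 1) * s1)) - 2 * (F x - (f 1 + (x - 1) * s1))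
          + (F (x - u) - (f 1 + (x - u - 1) * s1))"
        by (simp add: algebra_simps)
      moreover note R[of "x + u"] R[of x] R[of "x - u"]
      ultimately show ?thesis using 2 u h by argo
    next
      case 3
      then have "\<bar>F (x + u) - 2 * F x + F (x - u)\<bar> \<le> w"
        using x u FI[of x] FI[of "x + u"] FI[of "x - u"]
          second_diff_leD[OF w u(1,2), of x] by auto
      then show ?thesis using w0 by simp
    qed
  qed
  with that cont FI show thesis by blast
qed

lemma continuous_has_antiderivative:
  fixes F :: "real \<Rightarrow> real"
  assumes "continuous_on UNIV F"
  obtains G where "\<And>x. (G has_real_derivative F x) (at x)"
proof -
  have "\<exists>G. \<forall>x::real. -\<infinity> < ereal x \<longrightarrow> ereal x < \<infinity> \<longrightarrow> (G has_vector_derivative F x) (at x)"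
    using assms by (intro einterval_antiderivative) (auto simp: continuous_on_eq_continuous_at)
  then show thesis
    using that by (auto simp: has_real_derivative_iff_has_vector_derivative)
qed

lemma second_order_remainder:
  fixes p :: "real \<Rightarrow> real"
  assumes p': "\<And>x. (p has_real_derivative p' x) (at x)"
    and p'': "\<And>x. (p' has_real_derivative p'' x) (at x)"
    and x: "x \<in> {a..b}" and y: "y \<in> {a..b}"
    and M: "\<And>z. z \<in> {a..b} \<Longrightarrow> \<bar>p'' z\<bar> \<le> M"
  shows "\<bar>p y - p x - p' x * (y - x)\<bar> \<le> M / 2 * (y - x)\<^sup>2"
proof (cases "x = y")
  case False
  define d where "d m = (if m = 0 then p else if m = 1 then p' else p'')" for m :: nat
  have "\<exists>t. (if y < x then y < t \<and> t < x else x < t \<and> t < y) \<and>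
      p y = (\<Sum>m<2. (d m x / fact m) * (y - x) ^ m) + (d 2 t / fact 2) * (y - x) ^ 2"
  proof (rule Taylor)
    show "\<forall>m t. m < 2 \<and> min x y \<le> t \<and> t \<le> max x y \<longrightarrow> (d m has_real_derivative d (Suc m) t) (at t)"
      using p' p'' by (auto simp: d_def less_Suc_eq numeral_2_eq_2)
  qed (use False in \<open>auto simp: d_def\<close>)
  then obtain t where between: "if y < x then y < t \<and> t < x else x < t \<and> t < y"
    and expansion: "p y = (\<Sum>m<2. (d m x / fact m) * (y - x) ^ m) + (d 2 t / fact 2) * (y - x) ^ 2"
    by blast
  have t: "t \<in> {a..b}"
    using between x y by (auto split: if_splits)
  have e: "p y = p x + p' x * (y - x) + p'' t / 2 * (y - x)\<^sup>2"
    using expansion by (simp add: d_def numeral_2_eq_2)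
  have "\<bar>p y - p x - p' x * (y - x)\<bar> = \<bar>p'' t\<bar> / 2 * (y - x)\<^sup>2"
    unfolding e by (simp add: abs_mult)
  also have "\<dots> \<le> M / 2 * (y - x)\<^sup>2"
    using M[OF t] by (intro mult_right_mono) auto
  finally show ?thesis .
qed simp

text \<open>A form of $|g''|\le A$, $|g'|\le B$ on $[0,1]$ that speaks of tangent lines only,
  because tangent lines are what a positive operator can be applied to.\<close>

definition tangent_bounds :: "real \<Rightarrow> real \<Rightarrow> (real \<Rightarrow> real) \<Rightarrow> bool" where
  "tangent_bounds A B g \<longleftrightarrow>
     (\<exists>g'. \<forall>x\<in>{0..1}. \<bar>g' x\<bar> \<le> B \<and>
        (\<forall>y\<in>{0..1}. \<bar>g y - g x - g' x * (y - x)\<bar> \<le> A / 2 * (y - x)\<^sup>2))"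

text \<open>The approximant is the second central difference quotient, with step $h$, of a second
  antiderivative $F_2$ of the extension of $f$; equivalently a double moving average of it. Its
  second derivative is then a second difference quotient of the extension itself, and its
  distance from $f$ is the second-order Taylor remainder in $u$ of
  $F_2(x+u)-2F_2(x)+F_2(x-u)-f(x)u^2$.\<close>

lemma smooth_approximation:
  assumes f: "f \<in> C01" and h: "0 < h" "h \<le> 1/2" and w: "second_diff_le f h w"
    and N: "\<And>x. x \<in> {0..1} \<Longrightarrow> \<bar>f x\<bar> \<le> N"
  obtains g where "g \<in> C01" "\<And>x. x \<in> {0..1} \<Longrightarrow> \<bar>g x - f x\<bar> \<le> 2 * w"
    "tangent_bounds (4 * w / h\<^sup>2) (4 * N + 8 * w + 2 * w / h\<^sup>2) g"
proof -
  obtain F :: "real \<Rightarrow> real" where F: "continuous_on UNIV F" "\<And>x. x \<in> {0..1} \<Longrightarrow> F x = f x"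
    and D: "\<And>x u. \<lbrakk>x \<in> {0..1}; 0 \<le> u; u \<le> h\<rbrakk> \<Longrightarrow> \<bar>F (x + u) - 2 * F x + F (x - u)\<bar> \<le> 4 * w"
    using extension_second_diff[OF f h w] by blast
  obtain F1 where F1: "\<And>x. (F1 has_real_derivative F x) (at x)"
    using continuous_has_antiderivative[OF F(1)] by blast
  then have "continuous_on UNIV F1"
    by (meson DERIV_isCont continuous_at_imp_continuous_on)
  then obtain F2 where F2: "\<And>x. (F2 has_real_derivative F1 x) (at x)"
    using continuous_has_antiderivative by blast
  note [derivative_intros] = DERIV_chain2[OF F1] DERIV_chain2[OF F2]
  define g where "g x = (F2 (x + h) - 2 * F2 x + F2 (x - h)) / h\<^sup>2" for x
  define g' where "g' x = (F1 (x + h) - 2 * F1 x + F1 (x - h)) / h\<^sup>2" for x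
  define g'' where "g'' x = (F (x + h) - 2 * F x + F (x - h)) / h\<^sup>2" for x
  have dg: "(g has_real_derivative g' x) (at x)" for x
    unfolding g_def g'_def by (rule DERIV_cdivide) (auto intro!: derivative_eq_intros)
  have dg': "(g' has_real_derivative g'' x) (at x)" for x
    unfolding g'_def g''_def by (rule DERIV_cdivide) (auto intro!: derivative_eq_intros)
  have A: "\<bar>g'' x\<bar> \<le> 4 * w / h\<^sup>2" if "x \<in> {0..1}" for x
    using D[OF that, of h] h by (simp add: g''_def divide_right_mono)
  have gf: "\<bar>g x - f x\<bar> \<le> 2 * w" if x: "x \<in> {0..1}" for x
  proof -
    define p where "p u = F2 (x + u) - 2 * F2 x + F2 (x - u) - F x * u\<^sup>2" for u
    define p' where "p' u = F1 (x + u) - F1 (x - u) - 2 * F x * u" for u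
    have "(p has_real_derivative p' u) (at u)" for u
      unfolding p_def p'_def by (auto intro!: derivative_eq_intros)
    moreover have "(p' has_real_derivative F (x + u) - 2 * F x + F (x - u)) (at u)" for u
      unfolding p'_def by (auto intro!: derivative_eq_intros)
    ultimately have "\<bar>p h - p 0 - p' 0 * (h - 0)\<bar> \<le> 4 * w / 2 * (h - 0)\<^sup>2"
      by (rule second_order_remainder[where a = 0 and b = h]) (use x h D in auto)
    then have "\<bar>p h\<bar> \<le> 2 * w * h\<^sup>2"
      by (simp add: p_def p'_def)
    moreover have "p h = (g x - f x) * h\<^sup>2"
      using h F(2)[OF x] by (simp add: p_def g_def field_simps)
    ultimately show ?thesis
      using h by (simp add: abs_mult)
  qed
  have gN: "\<bar>g x\<bar> \<le> N + 2 * w" if "x \<in> {0..1}" for x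
    using gf[OF that] N[OF that] by linarith
  have tangent: "\<bar>g y - g x - g' x * (y - x)\<bar> \<le> 4 * w / h\<^sup>2 / 2 * (y - x)\<^sup>2"
    if "x \<in> {0..1}" "y \<in> {0..1}" for x y
    by (rule second_order_remainder[OF dg dg' that A])
  have slope: "\<bar>g' x\<bar> \<le> 4 * N + 8 * w + 2 * w / h\<^sup>2" if x: "x \<in> {0..1}" for x
  proof -
    define A where "A = 4 * w / h\<^sup>2"
    \<comment> \<open>A point at distance 1/2 turns the bounds on g and on the tangent error into one on the
      slope.\<close>
    define y :: real where "y = (if x \<le> 1/2 then x + 1/2 else x - 1/2)"
    have y: "y \<in> {0..1}" and yx: "\<bar>y - x\<bar> = 1/2"
      using x by (auto simp: y_def)
    have sq: "(y - x)\<^sup>2 = 1/4"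
      by (simp add: y_def power_divide)
    have "\<bar>g' x * (y - x)\<bar> = \<bar>g' x\<bar> / 2"
      using yx by (simp add: abs_mult)
    moreover have "\<bar>g y - g x - g' x * (y - x)\<bar> \<le> A / 8"
      using tangent[OF x y] sq by (simp add: A_def)
    ultimately have "\<bar>g' x\<bar> \<le> 4 * (N + 2 * w) + A / 4"
      using gN[OF x] gN[OF y] by argo
    moreover have "0 \<le> A" using second_diff_le_nonneg[OF w] h by (simp add: A_def)
    ultimately show ?thesis by (simp add: A_def)
  qed
  have "g \<in> C01"
    using dg by (auto simp: C01_def intro: DERIV_isCont continuous_at_imp_continuous_on)
  moreover have "tangent_bounds (4 * w / h\<^sup>2) (4 * N + 8 * w + 2 * w / h\<^sup>2) g"
    unfolding tangent_bounds_def using slope tangent by blast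
  ultimately show thesis using gf by (intro that)
qed

text \<open>By uniform continuity the second differences of $f$ with small steps are small.\<close>

lemma smooth_dense:
  assumes f: "f \<in> C01" and e: "0 < e"
  obtains g A B where "g \<in> C01" "\<And>x. x \<in> {0..1} \<Longrightarrow> \<bar>g x - f x\<bar> \<le> e" "tangent_bounds A B g"
proof -
  have "uniformly_continuous_on {0..1} f"
    using f by (intro compact_uniformly_continuous) (auto simp: C01_def)
  moreover have "0 < e / 4" using e by simp
  ultimately obtain d where d: "0 < d"
    "\<And>x y. \<lbrakk>x \<in> {0..1}; y \<in> {0..1}; dist y x < d\<rbrakk> \<Longrightarrow> dist (f y) (f x) < e / 4"
    unfolding uniformly_continuous_on_def by blast
  define h where "h = min (d / 2) (1/2)"
  have h: "0 < h" "h \<le> 1/2" "h < d" using d by (auto simp: h_def)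
  have "second_diff_le f h (e / 2)"
    unfolding second_diff_le_def
  proof (intro allI impI)
    fix c u :: real
    assume u: "0 \<le> u" "u \<le> h" "0 \<le> c - u" "c + u \<le> 1"
    show "\<bar>f (c + u) - 2 * f c + f (c - u)\<bar> \<le> e / 2"
    proof -
      have "\<bar>f (c + u) - f c\<bar> < e / 4" "\<bar>f (c - u) - f c\<bar> < e / 4"
        using d(2)[of c "c + u"] d(2)[of c "c - u"] u h by (auto simp: dist_real_def)
      then show ?thesis by linarith
    qed
  qed
  then show thesis
  proof (rule smooth_approximation[OF f h(1,2) _ C01_abs_le_supnorm01[OF f]])
    fix g
    assume "g \<in> C01" "\<And>x. x \<in> {0..1} \<Longrightarrow> \<bar>g x - f x\<bar> \<le> 2 * (e / 2)"
      "tangent_bounds (4 * (e / 2) / h\<^sup>2) (4 * supnorm01 f + 8 * (e / 2) + 2 * (e / 2) / h\<^sup>2) g"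
    then show thesis by (intro that) simp_all
  qed
qed

section \<open>Positive operators fixing the constants\<close>

lemma e_fun_C01 [simp]: "e_fun i \<in> C01"
  by (auto simp: C01_def e_fun_def intro!: continuous_intros)

text \<open>These are the operators given at each point by integration against a probability measure
  on $[0,1]$.\<close>

locale markov01 =
  fixes T :: "(real \<Rightarrow> real) \<Rightarrow> real \<Rightarrow> real"
  assumes positive: "positive_linear_operator01 T" and unital: "eq01 (T (e_fun 0)) (e_fun 0)"
begin

lemma in_C01: "f \<in> C01 \<Longrightarrow> T f \<in> C01"
  using positive
  unfolding positive_linear_operator01_def linear_operator01_def operator01_def by blast

lemma nonneg: "\<lbrakk>f \<in> C01; \<And>y. y \<in> {0..1} \<Longrightarrow> 0 \<le> f y; x \<in> {0..1}\<rbrakk> \<Longrightarrow> 0 \<le> T f x"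
  using positive unfolding positive_linear_operator01_def by blast

lemma respects:
  "\<lbrakk>f \<in> C01; g \<in> C01; \<And>x. x \<in> {0..1} \<Longrightarrow> f x = g x; x \<in> {0..1}\<rbrakk> \<Longrightarrow> T f x = T g x"
  using positive
  unfolding positive_linear_operator01_def linear_operator01_def operator01_def eq01_def by blast

lemma combination:
  assumes "f \<in> C01" "g \<in> C01" "x \<in> {0..1}"
  shows "T (\<lambda>y. a * f y + b * g y) x = a * T f x + b * T g x"
proof -
  have sc: "\<And>c f. f \<in> C01 \<Longrightarrow> (\<lambda>y. c * f y) \<in> C01"
    by (auto simp: C01_def intro!: continuous_intros)
  have add: "\<forall>f\<in>C01. \<forall>g\<in>C01. \<forall>x\<in>{0..1}. T (\<lambda>x. f x + g x) x = T f x + T g x"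
    and scale: "\<forall>c. \<forall>f\<in>C01. \<forall>x\<in>{0..1}. T (\<lambda>x. c * f x) x = c * T f x"
    using positive unfolding positive_linear_operator01_def linear_operator01_def eq01_def
    by fast+
  have "T (\<lambda>y. a * f y + b * g y) x = T (\<lambda>y. a * f y) x + T (\<lambda>y. b * g y) x"
    by (rule add[rule_format, OF sc[OF assms(1)] sc[OF assms(2)] assms(3)])
  also have "T (\<lambda>y. a * f y) x = a * T f x"
    by (rule scale[rule_format, OF assms(1,3)])
  also have "T (\<lambda>y. b * g y) x = b * T g x"
    by (rule scale[rule_format, OF assms(2,3)])
  finally show ?thesis .
qed

lemma mono:
  assumes "f \<in> C01" "g \<in> C01" "\<And>x. x \<in> {0..1} \<Longrightarrow> f x \<le> g x" "x \<in> {0..1}"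
  shows "T f x \<le> T g x"
proof -
  have "(\<lambda>y. 1 * g y + (-1) * f y) \<in> C01"
    using assms(1,2) by (auto simp: C01_def intro!: continuous_intros)
  then have "0 \<le> T (\<lambda>y. 1 * g y + (-1) * f y) x"
    using assms(3,4) by (intro nonneg) auto
  then show ?thesis
    using combination[OF assms(2,1,4), of 1 "-1"] by simp
qed

lemma affine:
  assumes "x \<in> {0..1}"
  shows "T (\<lambda>y. a + b * y) x = a + b * T (e_fun 1) x"
proof -
  have "T (\<lambda>y. a * e_fun 0 y + b * e_fun 1 y) x = a * T (e_fun 0) x + b * T (e_fun 1) x"
    using e_fun_C01 e_fun_C01 assms by (rule combination)
  then show ?thesis
    using unital assms by (simp add: e_fun_def eq01_def)
qed

lemma contraction:
  assumes "f \<in> C01" "g \<in> C01" "\<And>x. x \<in> {0..1} \<Longrightarrow> \<bar>f x - g x\<bar> \<le> e" "x \<in> {0..1}"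
  shows "\<bar>T f x - T g x\<bar> \<le> e"
proof -
  have *: "T p x \<le> T q x + e"
    if "p \<in> C01" "q \<in> C01" "\<And>y. y \<in> {0..1} \<Longrightarrow> p y \<le> q y + e" for p q
  proof -
    have c: "(\<lambda>y. e + 0 * y) \<in> C01" by (auto simp: C01_def)
    have "(\<lambda>y. 1 * q y + 1 * (e + 0 * y)) \<in> C01"
      using that by (auto simp: C01_def intro!: continuous_intros)
    then have "T p x \<le> T (\<lambda>y. 1 * q y + 1 * (e + 0 * y)) x"
      using that assms(4) by (intro mono) auto
    then show ?thesis
      using combination[OF that(2) c assms(4), of 1 1] affine[OF assms(4), of e 0] by simp
  qed
  have "\<And>y. y \<in> {0..1} \<Longrightarrow> f y \<le> g y + e" "\<And>y. y \<in> {0..1} \<Longrightarrow> g y \<le> f y + e"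
    using assms(3) by force+
  then show ?thesis
    using *[OF assms(1,2)] *[OF assms(2,1)] by (simp add: abs_le_iff)
qed

lemma e_fun_image:
  assumes "x \<in> {0..1}"
  shows "T (e_fun i) x \<in> {0..1}"
proof -
  have "T (e_fun i) x \<le> T (e_fun 0) x"
    using assms by (intro mono e_fun_C01) (auto simp: e_fun_def power_le_one)
  moreover have "0 \<le> T (e_fun i) x"
    using assms by (intro nonneg e_fun_C01) (simp_all add: e_fun_def)
  ultimately show ?thesis
    using unital assms by (auto simp: eq01_def e_fun_def)
qed

end

lemma combination_C01: "\<lbrakk>f \<in> C01; g \<in> C01\<rbrakk> \<Longrightarrow> (\<lambda>x. a * f x + b * g x) \<in> C01"
  by (auto simp: C01_def intro!: continuous_intros)

text \<open>Additivity and homogeneity are merged into one law, which composition and pointwise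
  limits preserve in a single step.\<close>

lemma markov01I:
  assumes "\<And>f. f \<in> C01 \<Longrightarrow> T f \<in> C01"
    and "\<And>f g x. \<lbrakk>f \<in> C01; g \<in> C01; \<And>y. y \<in> {0..1} \<Longrightarrow> f y = g y; x \<in> {0..1}\<rbrakk> \<Longrightarrow> T f x = T g x"
    and comb: "\<And>f g a b x. \<lbrakk>f \<in> C01; g \<in> C01; x \<in> {0..1}\<rbrakk> \<Longrightarrow>
          T (\<lambda>y. a * f y + b * g y) x = a * T f x + b * T g x"
    and "\<And>f x. \<lbrakk>f \<in> C01; \<And>y. y \<in> {0..1} \<Longrightarrow> 0 \<le> f y; x \<in> {0..1}\<rbrakk> \<Longrightarrow> 0 \<le> T f x"
    and "\<And>x. x \<in> {0..1} \<Longrightarrow> T (e_fun 0) x = 1"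
  shows "markov01 T"
proof
  show "positive_linear_operator01 T"
    unfolding positive_linear_operator01_def linear_operator01_def operator01_def eq01_def
  proof (intro conjI ballI allI impI)
    show "T (\<lambda>x. f x + g x) x = T f x + T g x" if "f \<in> C01" "g \<in> C01" "x \<in> {0..1}" for f g x
      using comb[OF that, of 1 1] by simp
    show "T (\<lambda>x. c * f x) x = c * T f x" if "f \<in> C01" "x \<in> {0..1}" for c f x
      using comb[OF that(1,1,2), of c 0] by simp
    show "T f \<in> C01" if "f \<in> C01" for f
      by (rule assms(1)[OF that])
    show "T f x = T g x" if "f \<in> C01" "g \<in> C01" "\<forall>y\<in>{0..1}. f y = g y" "x \<in> {0..1}" for f g x
      using that(3) by (intro assms(2)[OF that(1,2) _ that(4)]) blast
    show "0 \<le> T f x" if "f \<in> C01" "\<forall>y\<in>{0..1}. 0 \<le> f y" "x \<in> {0..1}" for f x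
      using that(2) by (intro assms(4)[OF that(1) _ that(3)]) blast
  qed
  show "eq01 (T (e_fun 0)) (e_fun 0)"
    using assms(5) by (simp add: eq01_def e_fun_def)
qed

lemma (in markov01) iterate_markov01: "markov01 (T ^^ m)"
proof (induction m)
  case 0
  show ?case by (rule markov01I) (auto simp: e_fun_def)
next
  case (Suc m)
  interpret M: markov01 "T ^^ m" by fact
  show ?case
  proof (rule markov01I)
    show "(T ^^ Suc m) (\<lambda>y. a * f y + b * g y) x = a * (T ^^ Suc m) f x + b * (T ^^ Suc m) g x"
      if "f \<in> C01" "g \<in> C01" "x \<in> {0..1}" for f g a b x
    proof -
      have "(T ^^ Suc m) (\<lambda>y. a * f y + b * g y) x
        = T (\<lambda>y. a * (T ^^ m) f y + b * (T ^^ m) g y) x"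
        unfolding funpow.simps comp_apply
        by (rule respects; (intro combination_C01 M.in_C01 M.combination that)?)
      also have "\<dots> = a * (T ^^ Suc m) f x + b * (T ^^ Suc m) g x"
        using that by (simp add: combination M.in_C01)
      finally show ?thesis .
    qed
    show "(T ^^ Suc m) f x = (T ^^ Suc m) g x"
      if "f \<in> C01" "g \<in> C01" "\<And>y. y \<in> {0..1} \<Longrightarrow> f y = g y" "x \<in> {0..1}" for f g x
      unfolding funpow.simps comp_apply
      by (rule respects[OF M.in_C01[OF that(1)] M.in_C01[OF that(2)] M.respects[OF that(1-3)] that(4)])
    show "0 \<le> (T ^^ Suc m) f x"
      if "f \<in> C01" "\<And>y. y \<in> {0..1} \<Longrightarrow> 0 \<le> f y" "x \<in> {0..1}" for f x
      unfolding funpow.simps comp_apply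
      by (rule nonneg[OF M.in_C01[OF that(1)] M.nonneg[OF that(1,2)] that(3)])
    show "(T ^^ Suc m) (e_fun 0) x = 1" if "x \<in> {0..1}" for x
    proof -
      have "(T ^^ Suc m) (e_fun 0) x = T (e_fun 0) x"
        unfolding funpow.simps comp_apply
        using M.unital by (intro respects M.in_C01 e_fun_C01 that) (simp add: eq01_def)
      then show ?thesis using unital that by (simp add: eq01_def e_fun_def)
    qed
    show "(T ^^ Suc m) f \<in> C01" if "f \<in> C01" for f
      using in_C01[OF M.in_C01[OF that]] by simp
  qed
qed

section \<open>Monotonicity along the iterates\<close>

text \<open>These are in essence the convex decreasing functions, described by their
  supporting lines.\<close>

definition descending_supports :: "(real \<Rightarrow> real) \<Rightarrow> bool" where
  "descending_supports h \<longleftrightarrow>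
     (\<forall>x\<in>{0..1}. \<exists>s\<le>0. \<forall>y\<in>{0..1}. h x + s * (y - x) \<le> h y)"

locale subdiagonal01 = markov01 +
  assumes e1_le: "x \<in> {0..1} \<Longrightarrow> T (e_fun 1) x \<le> x"
begin

text \<open>The operator $T$ moves the value at $x$ of the supporting line at $x$ by
  $s(T(e_1;x)-x)$, a product of two nonpositive numbers.\<close>

lemma descending_supports_increase:
  assumes h: "h \<in> C01" "descending_supports h" and x: "x \<in> {0..1}"
  shows "h x \<le> T h x"
proof -
  obtain s where s: "s \<le> 0" "\<And>y. y \<in> {0..1} \<Longrightarrow> h x + s * (y - x) \<le> h y"
    using h(2) x unfolding descending_supports_def by blast
  have "h x \<le> h x + s * (T (e_fun 1) x - x)"
    using s(1) e1_le[OF x] by (simp add: mult_nonpos_nonpos)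
  also have "\<dots> = T (\<lambda>y. (h x - s * x) + s * y) x"
    using affine[OF x, of "h x - s * x" s] by (simp add: algebra_simps)
  also have "\<dots> \<le> T h x"
  proof (rule mono)
    show "(\<lambda>y. (h x - s * x) + s * y) \<in> C01"
      by (auto simp: C01_def intro!: continuous_intros)
    show "(h x - s * x) + s * y \<le> h y" if "y \<in> {0..1}" for y
      using s(2)[OF that] by (simp add: algebra_simps)
  qed (use h x in auto)
  finally show ?thesis .
qed

lemma descending_supports_iterates_incseq:
  assumes h: "h \<in> C01" "descending_supports h" and x: "x \<in> {0..1}" and mn: "m \<le> n"
  shows "(T ^^ m) h x \<le> (T ^^ n) h x"
proof -
  have base: "h y \<le> (T ^^ p) h y" if "y \<in> {0..1}" for y p
    using that
  proof (induction p arbitrary: y)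
    case (Suc p)
    interpret P: markov01 "T ^^ p" by (rule iterate_markov01)
    have "h y \<le> T h y" using h Suc.prems by (rule descending_supports_increase)
    also have "\<dots> \<le> T ((T ^^ p) h) y"
      using Suc h by (intro mono) (auto intro: P.in_C01)
    finally show ?case by simp
  qed simp
  interpret M: markov01 "T ^^ m" by (rule iterate_markov01)
  interpret P: markov01 "T ^^ (n - m)" by (rule iterate_markov01)
  have "(T ^^ m) h x \<le> (T ^^ m) ((T ^^ (n - m)) h) x"
    using base h x by (intro M.mono P.in_C01) auto
  also have "\<dots> = (T ^^ n) h x"
    using mn by (metis funpow_add comp_apply le_add_diff_inverse)
  finally show ?thesis .
qed

text \<open>The functions $H_\sigma=\sigma g+\frac A2e_2-(A+B)e_1$ with $\sigma=\pm1$ have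
  descending supports: the quadratic term outweighs the deviation of $\pm g$ from its tangents,
  and the linear term makes all slopes nonpositive, as $\sigma g'(z)+Az\le A+B$ on $[0,1]$. The
  monotonicity of $T^mH_\sigma$ for both signs bounds the increments of $T^mg$ from both
  sides.\<close>

lemma tangent_bounds_iterates:
  assumes g: "g \<in> C01" "tangent_bounds A B g" and x: "x \<in> {0..1}"
  shows "\<bar>(T ^^ m) g x - (T ^^ n) g x\<bar> \<le>
     A / 2 * \<bar>(T ^^ m) (e_fun 2) x - (T ^^ n) (e_fun 2) x\<bar> +
     (A + B) * \<bar>(T ^^ m) (e_fun 1) x - (T ^^ n) (e_fun 1) x\<bar>"
proof -
  obtain g' where g': "\<And>x. x \<in> {0..1} \<Longrightarrow> \<bar>g' x\<bar> \<le> B"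
    "\<And>x y. \<lbrakk>x \<in> {0..1}; y \<in> {0..1}\<rbrakk> \<Longrightarrow> \<bar>g y - g x - g' x * (y - x)\<bar> \<le> A / 2 * (y - x)\<^sup>2"
    using g(2) unfolding tangent_bounds_def by blast
  have A: "0 \<le> A" using order_trans[OF abs_ge_zero g'(2)[of 0 1]] by simp
  have B: "0 \<le> B" using order_trans[OF abs_ge_zero g'(1)[of 0]] by simp
  define H where "H \<sigma> y = \<sigma> * g y + 1 * (A / 2 * e_fun 2 y + (-(A + B)) * e_fun 1 y)" for \<sigma> y
  have q: "(\<lambda>y. A / 2 * e_fun 2 y + (-(A + B)) * e_fun 1 y) \<in> C01"
    by (rule combination_C01) simp_all
  have H: "H \<sigma> \<in> C01" for \<sigma>
    unfolding H_def[abs_def] by (rule combination_C01[OF g(1) q])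
  have sup: "descending_supports (H \<sigma>)" if \<sigma>: "\<bar>\<sigma>\<bar> = 1" for \<sigma>
    unfolding descending_supports_def
  proof (intro ballI exI conjI)
    fix z :: real
    assume z: "z \<in> {0..1}"
    show "\<sigma> * g' z + A * z - (A + B) \<le> 0"
    proof -
      have "\<sigma> * g' z \<le> \<bar>\<sigma> * g' z\<bar>" by simp
      also have "\<dots> \<le> B" using \<sigma> g'(1)[OF z] by (simp add: abs_mult)
      finally have "\<sigma> * g' z \<le> B" .
      moreover have "A * z \<le> A * 1" using A z by (intro mult_left_mono) auto
      ultimately show ?thesis by simp
    qed
    fix y :: real
    assume y: "y \<in> {0..1}"
    define r where "r = g y - g z - g' z * (y - z)"
    have "\<bar>\<sigma> * r\<bar> \<le> A / 2 * (y - z)\<^sup>2"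
      using \<sigma> g'(2)[OF z y] by (simp add: abs_mult r_def)
    then have "0 \<le> \<sigma> * r + A / 2 * (y - z)\<^sup>2" by linarith
    also have "\<sigma> * r + A / 2 * (y - z)\<^sup>2
        = H \<sigma> y - (H \<sigma> z + (\<sigma> * g' z + A * z - (A + B)) * (y - z))"
      by (simp add: r_def H_def e_fun_def power2_eq_square field_simps)
    finally show "H \<sigma> z + (\<sigma> * g' z + A * z - (A + B)) * (y - z) \<le> H \<sigma> y" by simp
  qed
  have TH: "(T ^^ k) (H \<sigma>) x = \<sigma> * (T ^^ k) g x
      + (A / 2 * (T ^^ k) (e_fun 2) x - (A + B) * (T ^^ k) (e_fun 1) x)" for k \<sigma>
  proof -
    interpret K: markov01 "T ^^ k" by (rule iterate_markov01)
    show ?thesis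
      unfolding H_def[abs_def] K.combination[OF g(1) q x] K.combination[OF e_fun_C01 e_fun_C01 x]
      by (simp add: algebra_simps)
  qed
  have main: "\<bar>(T ^^ i) g x - (T ^^ j) g x\<bar> \<le>
     A / 2 * \<bar>(T ^^ i) (e_fun 2) x - (T ^^ j) (e_fun 2) x\<bar> +
     (A + B) * \<bar>(T ^^ i) (e_fun 1) x - (T ^^ j) (e_fun 1) x\<bar>" if "i \<le> j" for i j
  proof -
    have 1: "(T ^^ i) (H 1) x \<le> (T ^^ j) (H 1) x"
      and 2: "(T ^^ i) (H (-1)) x \<le> (T ^^ j) (H (-1)) x"
      using that by (auto intro!: descending_supports_iterates_incseq H sup x)
    have "\<bar>(T ^^ i) g x - (T ^^ j) g x\<bar> \<le>
       A / 2 * ((T ^^ j) (e_fun 2) x - (T ^^ i) (e_fun 2) x) +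
       (A + B) * ((T ^^ i) (e_fun 1) x - (T ^^ j) (e_fun 1) x)"
      using 1 2 unfolding TH by (simp add: abs_le_iff algebra_simps)
    also have "\<dots> \<le> A / 2 * \<bar>(T ^^ i) (e_fun 2) x - (T ^^ j) (e_fun 2) x\<bar> +
       (A + B) * \<bar>(T ^^ i) (e_fun 1) x - (T ^^ j) (e_fun 1) x\<bar>"
      using A B by (intro add_mono mult_left_mono) auto
    finally show ?thesis .
  qed
  show ?thesis
    using main[of m n] main[of n m] by (cases "m \<le> n") (auto simp: abs_minus_commute)
qed

end

section \<open>The limit operator\<close>

locale convergent01 = subdiagonal01 +
  assumes e1_Cauchy: "uniformly_Cauchy_on {0..1} (\<lambda>m. (T ^^ m) (e_fun 1))"
    and e2_Cauchy: "uniformly_Cauchy_on {0..1} (\<lambda>m. (T ^^ m) (e_fun 2))"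
begin

text \<open>Convergence at $e_1$ and $e_2$ spreads to smooth functions by the increment bound, and from
  there to all continuous functions since all iterates are contractions.\<close>

lemma iterates_Cauchy:
  assumes f: "f \<in> C01"
  shows "uniformly_Cauchy_on {0..1} (\<lambda>m. (T ^^ m) f)"
proof (rule uniformly_Cauchy_onI)
  fix e :: real
  assume e: "0 < e"
  obtain g A B where g: "g \<in> C01" "\<And>x. x \<in> {0..1} \<Longrightarrow> \<bar>g x - f x\<bar> \<le> e / 4"
    and AB: "tangent_bounds A B g"
    using smooth_dense[OF f, of "e / 4"] e by auto
  \<comment> \<open>K exceeds both coefficients of the increment bound, and with tolerance d the two terms
    together contribute e / 4, as does each of the two replacements of f by g.\<close>
  define K where "K = \<bar>A\<bar> + \<bar>B\<bar> + 1"
  have "K > 0" by (simp add: K_def)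
  define d where "d = e / (8 * K)"
  have d: "0 < d" using e \<open>K > 0\<close> by (simp add: d_def)
  obtain M1 where M1: "\<And>x m n. \<lbrakk>x \<in> {0..1}; M1 \<le> m; M1 \<le> n\<rbrakk> \<Longrightarrow>
      dist ((T ^^ m) (e_fun 1) x) ((T ^^ n) (e_fun 1) x) < d"
    using e1_Cauchy d unfolding uniformly_Cauchy_on_def by meson
  obtain M2 where M2: "\<And>x m n. \<lbrakk>x \<in> {0..1}; M2 \<le> m; M2 \<le> n\<rbrakk> \<Longrightarrow>
      dist ((T ^^ m) (e_fun 2) x) ((T ^^ n) (e_fun 2) x) < d"
    using e2_Cauchy d unfolding uniformly_Cauchy_on_def by meson
  show "\<exists>M. \<forall>x\<in>{0..1}. \<forall>m\<ge>M. \<forall>n\<ge>M. dist ((T ^^ m) f x) ((T ^^ n) f x) < e"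
  proof (intro exI ballI allI impI)
    fix x :: real and m n
    assume x: "x \<in> {0..1}" and mn: "max M1 M2 \<le> m" "max M1 M2 \<le> n"
    interpret M: markov01 "T ^^ m" by (rule iterate_markov01)
    interpret N: markov01 "T ^^ n" by (rule iterate_markov01)
    define a1 where "a1 = \<bar>(T ^^ m) (e_fun 1) x - (T ^^ n) (e_fun 1) x\<bar>"
    define a2 where "a2 = \<bar>(T ^^ m) (e_fun 2) x - (T ^^ n) (e_fun 2) x\<bar>"
    have a: "0 \<le> a1" "a1 \<le> d" "0 \<le> a2" "a2 \<le> d"
      using M1[OF x, of m n] M2[OF x, of m n] mn by (auto simp: a1_def a2_def dist_real_def)
    have "\<bar>(T ^^ m) g x - (T ^^ n) g x\<bar> \<le> A / 2 * a2 + (A + B) * a1"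
      unfolding a1_def a2_def by (rule tangent_bounds_iterates[OF g(1) AB x])
    also have "\<dots> \<le> K * d + K * d"
      using a by (intro add_mono mult_mono) (auto simp: K_def)
    also have "\<dots> = e / 4" using \<open>K > 0\<close> by (simp add: d_def field_simps)
    finally have "\<bar>(T ^^ m) g x - (T ^^ n) g x\<bar> \<le> e / 4" .
    moreover have "\<bar>(T ^^ m) g x - (T ^^ m) f x\<bar> \<le> e / 4"
      by (rule M.contraction[OF g(1) f g(2) x])
    moreover have "\<bar>(T ^^ n) g x - (T ^^ n) f x\<bar> \<le> e / 4"
      by (rule N.contraction[OF g(1) f g(2) x])
    ultimately show "dist ((T ^^ m) f x) ((T ^^ n) f x) < e"
      using e unfolding dist_real_def by linarith
  qed
qed

definition Tinf :: "(real \<Rightarrow> real) \<Rightarrow> real \<Rightarrow> real" where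
  "Tinf f x = lim (\<lambda>m. (T ^^ m) f x)"

lemma iterates_uniform_limit:
  "f \<in> C01 \<Longrightarrow> uniform_limit {0..1} (\<lambda>m. (T ^^ m) f) (Tinf f) sequentially"
  using iterates_Cauchy[of f] Cauchy_uniformly_convergent
    uniformly_convergent_uniform_limit_iff
  unfolding Tinf_def[abs_def] by blast

lemma iterates_tendsto:
  "\<lbrakk>f \<in> C01; x \<in> {0..1}\<rbrakk> \<Longrightarrow> (\<lambda>m. (T ^^ m) f x) \<longlonglongrightarrow> Tinf f x"
  using iterates_uniform_limit by (rule tendsto_uniform_limitI)

lemma Tinf_markov01: "markov01 Tinf"
proof (rule markov01I)
  show "Tinf f \<in> C01" if "f \<in> C01" for f
  proof -
    have "(T ^^ m) f \<in> C01" for m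
      using markov01.in_C01[OF iterate_markov01 that] .
    then have "\<forall>\<^sub>F m in sequentially. continuous_on {0..1} ((T ^^ m) f)"
      by (simp add: C01_def)
    then show ?thesis
      using uniform_limit_theorem[OF _ iterates_uniform_limit[OF that]] by (simp add: C01_def)
  qed
  show "Tinf f x = Tinf g x"
    if "f \<in> C01" "g \<in> C01" "\<And>y. y \<in> {0..1} \<Longrightarrow> f y = g y" "x \<in> {0..1}" for f g x
    using markov01.respects[OF iterate_markov01 that] by (simp add: Tinf_def)
  show "Tinf (\<lambda>y. a * f y + b * g y) x = a * Tinf f x + b * Tinf g x"
    if "f \<in> C01" "g \<in> C01" "x \<in> {0..1}" for f g a b x
  proof (rule LIMSEQ_unique)
    show "(\<lambda>m. (T ^^ m) (\<lambda>y. a * f y + b * g y) x) \<longlonglongrightarrow> Tinf (\<lambda>y. a * f y + b * g y) x"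
      by (intro iterates_tendsto combination_C01 that)
    show "(\<lambda>m. (T ^^ m) (\<lambda>y. a * f y + b * g y) x) \<longlonglongrightarrow> a * Tinf f x + b * Tinf g x"
      unfolding markov01.combination[OF iterate_markov01 that]
      by (intro tendsto_intros iterates_tendsto that)
  qed
  show "0 \<le> Tinf f x" if "f \<in> C01" "\<And>y. y \<in> {0..1} \<Longrightarrow> 0 \<le> f y" "x \<in> {0..1}" for f x
  proof (rule LIMSEQ_le_const[OF iterates_tendsto[OF that(1,3)]])
    show "\<exists>N. \<forall>n\<ge>N. 0 \<le> (T ^^ n) f x"
      by (intro exI allI impI markov01.nonneg[OF iterate_markov01] that)
  qed
  show "Tinf (e_fun 0) x = 1" if "x \<in> {0..1}" for x
    using markov01.unital[OF iterate_markov01] that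
    by (simp add: Tinf_def eq01_def e_fun_def)
qed

lemma tangent_bounds_limit:
  assumes g: "g \<in> C01" "tangent_bounds A B g" and x: "x \<in> {0..1}"
  shows "\<bar>(T ^^ m) g x - Tinf g x\<bar> \<le>
     A / 2 * \<bar>Tinf (e_fun 2) x - (T ^^ m) (e_fun 2) x\<bar> + (A + B) * delta_iter T Tinf m x"
proof -
  have "\<bar>(T ^^ m) g x - Tinf g x\<bar> \<le>
     A / 2 * \<bar>(T ^^ m) (e_fun 2) x - Tinf (e_fun 2) x\<bar> +
     (A + B) * \<bar>(T ^^ m) (e_fun 1) x - Tinf (e_fun 1) x\<bar>"
  proof (rule LIMSEQ_le)
    show "(\<lambda>n. \<bar>(T ^^ m) g x - (T ^^ n) g x\<bar>) \<longlonglongrightarrow> \<bar>(T ^^ m) g x - Tinf g x\<bar>"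
      by (rule tendsto_rabs[OF tendsto_diff[OF tendsto_const iterates_tendsto[OF g(1) x]]])
    show "(\<lambda>n. A / 2 * \<bar>(T ^^ m) (e_fun 2) x - (T ^^ n) (e_fun 2) x\<bar> +
        (A + B) * \<bar>(T ^^ m) (e_fun 1) x - (T ^^ n) (e_fun 1) x\<bar>) \<longlonglongrightarrow>
      A / 2 * \<bar>(T ^^ m) (e_fun 2) x - Tinf (e_fun 2) x\<bar> +
        (A + B) * \<bar>(T ^^ m) (e_fun 1) x - Tinf (e_fun 1) x\<bar>"
      by (rule tendsto_add[OF tendsto_mult_left tendsto_mult_left];
          rule tendsto_rabs[OF tendsto_diff[OF tendsto_const iterates_tendsto[OF e_fun_C01 x]]])
    show "\<exists>N. \<forall>n\<ge>N. \<bar>(T ^^ m) g x - (T ^^ n) g x\<bar> \<le>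
        A / 2 * \<bar>(T ^^ m) (e_fun 2) x - (T ^^ n) (e_fun 2) x\<bar> +
        (A + B) * \<bar>(T ^^ m) (e_fun 1) x - (T ^^ n) (e_fun 1) x\<bar>"
      by (intro exI allI impI tangent_bounds_iterates[OF g x])
  qed
  then show ?thesis by (simp add: delta_iter_def abs_minus_commute)
qed

text \<open>The step $h=\frac12\sqrt\lambda$ is at most $1/2$ because $\lambda\le1$, the functions $T^me_i$ and
  $T^\infty e_i$ having values in $[0,1]$. With $g$ from \<open>smooth_approximation\<close>, $A=16w/\lambda$ and
  $B=4\|f\|+8w+\frac A2$; the replacement of $f$ by $g$ costs $4w$, and the increment bound
  costs $\frac A2\lambda+(\frac32A+8w)\delta\le 8w+24w+8w$ besides $4\|f\|\delta$, since $\delta\le\lambda\le1$.\<close>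

lemma limit_error_bound:
  assumes f: "f \<in> C01" and x: "x \<in> {0..1}"
  shows "\<bar>(T ^^ m) f x - Tinf f x\<bar>
     \<le> 44 * omega2 f (sqrt (lambda_iter T Tinf m x)) + 4 * supnorm01 f * delta_iter T Tinf m x"
proof -
  interpret M: markov01 "T ^^ m" by (rule iterate_markov01)
  interpret L: markov01 Tinf by (rule Tinf_markov01)
  define l where "l = lambda_iter T Tinf m x"
  define d where "d = delta_iter T Tinf m x"
  define d2 where "d2 = \<bar>Tinf (e_fun 2) x - (T ^^ m) (e_fun 2) x\<bar>"
  have d: "0 \<le> d" "d \<le> l" "0 \<le> d2" "d2 \<le> l"
    by (auto simp: d_def d2_def l_def delta_iter_def lambda_iter_def)
  have l1: "l \<le> 1"
    using M.e_fun_image[OF x, of 1] M.e_fun_image[OF x, of 2]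
      L.e_fun_image[OF x, of 1] L.e_fun_image[OF x, of 2]
    by (auto simp: l_def lambda_iter_def)
  have via: "\<bar>(T ^^ m) f x - Tinf f x\<bar> \<le> 2 * e + (A / 2 * d2 + (A + B) * d)"
    if "g \<in> C01" "\<And>y. y \<in> {0..1} \<Longrightarrow> \<bar>g y - f y\<bar> \<le> e" "tangent_bounds A B g" for g e A B
    using tangent_bounds_limit[OF that(1,3) x, of m] M.contraction[OF that(1) f that(2) x]
      L.contraction[OF that(1) f that(2) x]
    unfolding d_def[symmetric] d2_def[symmetric] by linarith
  show ?thesis
  proof (cases "l = 0")
    case True
    then have "d = 0" "d2 = 0" using d by auto
    \<comment> \<open>For smooth functions the error now vanishes, whatever their constants A and B.\<close>
    have "\<bar>(T ^^ m) f x - Tinf f x\<bar> \<le> 0 + e" if "0 < e" for e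
    proof -
      have "0 < e / 2" using that by simp
      then obtain g A B where "g \<in> C01" "\<And>y. y \<in> {0..1} \<Longrightarrow> \<bar>g y - f y\<bar> \<le> e / 2" "tangent_bounds A B g"
        using smooth_dense[OF f] by blast
      from via[OF this] show ?thesis by (simp add: \<open>d = 0\<close> \<open>d2 = 0\<close>)
    qed
    then have "\<bar>(T ^^ m) f x - Tinf f x\<bar> \<le> 0" by (rule field_le_epsilon)
    then show ?thesis
      using True \<open>d = 0\<close> by (simp add: l_def[symmetric] d_def[symmetric] omega2_def sup0_def)
  next
    case False
    then have l: "0 < l" using d by linarith
    define w where "w = omega2 f (sqrt l)"
    define h where "h = sqrt l / 2"
    have h: "0 < h" "h \<le> 1/2" "h \<le> sqrt l" using l l1 by (auto simp: h_def)
    have h2: "h\<^sup>2 = l / 4" using l by (simp add: h_def power_divide)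
    have w: "second_diff_le f h w"
      using second_diff_le_omega2[OF f, of "sqrt l"] l h(3)
      unfolding second_diff_le_def w_def by force
    have w0: "0 \<le> w" using second_diff_le_nonneg[OF w] h by simp
    obtain g where "g \<in> C01" "\<And>y. y \<in> {0..1} \<Longrightarrow> \<bar>g y - f y\<bar> \<le> 2 * w"
      "tangent_bounds (4 * w / h\<^sup>2) (4 * supnorm01 f + 8 * w + 2 * w / h\<^sup>2) g"
      using smooth_approximation[OF f h(1,2) w C01_abs_le_supnorm01[OF f]] by blast
    from via[OF this]
    have "\<bar>(T ^^ m) f x - Tinf f x\<bar> \<le>
        4 * w + 8 * (w / l * d2) + 24 * (w / l * d) + 8 * (w * d) + 4 * supnorm01 f * d"
      by (simp add: h2 algebra_simps)
    moreover have "w / l * d2 \<le> w / l * l" "w / l * d \<le> w / l * l" "w * d \<le> w * 1"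
      using w0 l l1 d by (intro mult_left_mono; simp)+
    ultimately show ?thesis
      using l by (simp add: w_def l_def[symmetric] d_def[symmetric])
  qed
qed

end

lemma supnorm01_uniform_limit:
  assumes "\<And>m. F m \<in> C01" "g \<in> C01" "(\<lambda>m. supnorm01 (\<lambda>x. F m x - g x)) \<longlonglongrightarrow> 0"
  shows "uniform_limit {0..1} F g sequentially"
proof (rule uniform_limitI)
  fix e :: real
  assume "0 < e"
  have c: "(\<lambda>x. F m x - g x) \<in> C01" for m
    using assms(1)[of m] assms(2) by (auto simp: C01_def intro!: continuous_intros)
  from order_tendstoD(2)[OF assms(3) \<open>0 < e\<close>]
  show "\<forall>\<^sub>F m in sequentially. \<forall>x\<in>{0..1}. dist (F m x) (g x) < e"
  proof eventually_elim
    case (elim m)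
    then show ?case using C01_abs_le_supnorm01[OF c[of m]] by (force simp: dist_real_def)
  qed
qed

theorem theorem1:
  "\<exists>k::real. k > 0 \<and>
     (\<forall>(T :: (real \<Rightarrow> real) \<Rightarrow> real \<Rightarrow> real) (g1 :: real \<Rightarrow> real) (g2 :: real \<Rightarrow> real).
        positive_linear_operator01 T \<longrightarrow>
        eq01 (T (e_fun 0)) (e_fun 0) \<longrightarrow>
        (\<forall>x\<in>{0..1}. T (e_fun 1) x \<le> x) \<longrightarrow>
        g1 \<in> C01 \<longrightarrow> g2 \<in> C01 \<longrightarrow>
        (\<lambda>m. supnorm01 (\<lambda>x. (T ^^ m) (e_fun 1) x - g1 x)) \<longlonglongrightarrow> 0 \<longrightarrow>
        (\<lambda>m. supnorm01 (\<lambda>x. (T ^^ m) (e_fun 2) x - g2 x)) \<longlonglongrightarrow> 0 \<longrightarrow>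
        (\<exists>Tinf :: (real \<Rightarrow> real) \<Rightarrow> real \<Rightarrow> real.
           positive_linear_operator01 Tinf \<and>
           eq01 (Tinf (e_fun 1)) g1 \<and> eq01 (Tinf (e_fun 2)) g2 \<and>
           (\<forall>m. \<forall>x\<in>{0..1}. \<forall>f\<in>C01.
              \<bar>(T ^^ m) f x - Tinf f x\<bar>
                \<le> k * omega2 f (sqrt (lambda_iter T Tinf m x))
                   + k * supnorm01 f * delta_iter T Tinf m x)))"
proof (intro exI[of _ 44] conjI allI impI)
  fix T :: "(real \<Rightarrow> real) \<Rightarrow> real \<Rightarrow> real" and g1 g2 :: "real \<Rightarrow> real"
  assume T: "positive_linear_operator01 T" "eq01 (T (e_fun 0)) (e_fun 0)"
      "\<forall>x\<in>{0..1}. T (e_fun 1) x \<le> x"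
    and g: "g1 \<in> C01" "g2 \<in> C01"
    and lim1: "(\<lambda>m. supnorm01 (\<lambda>x. (T ^^ m) (e_fun 1) x - g1 x)) \<longlonglongrightarrow> 0"
    and lim2: "(\<lambda>m. supnorm01 (\<lambda>x. (T ^^ m) (e_fun 2) x - g2 x)) \<longlonglongrightarrow> 0"
  interpret subdiagonal01 T by unfold_locales (use T in auto)
  have it: "(T ^^ m) (e_fun i) \<in> C01" for m i
    by (rule markov01.in_C01[OF iterate_markov01]) simp
  have u1: "uniform_limit {0..1} (\<lambda>m. (T ^^ m) (e_fun 1)) g1 sequentially"
    by (rule supnorm01_uniform_limit[OF it g(1) lim1])
  have u2: "uniform_limit {0..1} (\<lambda>m. (T ^^ m) (e_fun 2)) g2 sequentially"
    by (rule supnorm01_uniform_limit[OF it g(2) lim2])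
  interpret convergent01 T
  proof unfold_locales
    show "uniformly_Cauchy_on {0..1} (\<lambda>m. (T ^^ m) (e_fun 1))"
      using u1 by (intro uniformly_convergent_Cauchy uniformly_convergentI)
    show "uniformly_Cauchy_on {0..1} (\<lambda>m. (T ^^ m) (e_fun 2))"
      using u2 by (intro uniformly_convergent_Cauchy uniformly_convergentI)
  qed
  have "eq01 (Tinf (e_fun 1)) g1" "eq01 (Tinf (e_fun 2)) g2"
    unfolding eq01_def
    using LIMSEQ_unique[OF iterates_tendsto[OF e_fun_C01]] tendsto_uniform_limitI[OF u1]
      tendsto_uniform_limitI[OF u2] by blast+
  moreover have "\<bar>(T ^^ m) f x - Tinf f x\<bar>
        \<le> 44 * omega2 f (sqrt (lambda_iter T Tinf m x)) + 44 * supnorm01 f * delta_iter T Tinf m x"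
    if "x \<in> {0..1}" "f \<in> C01" for m x f
  proof -
    have "0 \<le> supnorm01 f * delta_iter T Tinf m x"
      using C01_abs_le_supnorm01[OF that(2,1)] by (simp add: delta_iter_def)
    then show ?thesis using limit_error_bound[OF that(2,1), of m] by simp
  qed
  ultimately show "\<exists>Tinf. positive_linear_operator01 Tinf \<and>
      eq01 (Tinf (e_fun 1)) g1 \<and> eq01 (Tinf (e_fun 2)) g2 \<and>
      (\<forall>m. \<forall>x\<in>{0..1}. \<forall>f\<in>C01. \<bar>(T ^^ m) f x - Tinf f x\<bar>
         \<le> 44 * omega2 f (sqrt (lambda_iter T Tinf m x))
            + 44 * supnorm01 f * delta_iter T Tinf m x)"
    using markov01.positive[OF Tinf_markov01] by blast
qed simp

end
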